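(* Let $m\in\mathbb Z\setminus\{0,1\}$ and let $K$ be the hyperbolic twist knot $J(2,2m)$, with knot group $\Pi(K)=\langle x,y\mid w^mx=yw^m\rangle$, $w=yx^{-1}y^{-1}x$. Let $u_0$ be a root of Riley's equation $\phi_K(1,u)=0$ corresponding to the holonomy representation, i.e. such that $x\mapsto\begin{pmatrix}1&1\\0&1\end{pmatrix}$, $y\mapsto\begin{pmatrix}1&0\\-u_0&1\end{pmatrix}$ defines a lift $\rho_0$ of the holonomy representation. Then the cusp shape $\mathfrak c$ of $K$ (computed with $\rho_0$) is $$\mathfrak c=\frac{2u_0+4}{u_0},$$ equivalently $$u_0=\frac{4}{\mathfrak c-2}.$$
   Context: **Twist knots.** For $m>0$, $J(2,2m)$ is the two-bridge knot $b(4m-1,2m-1)$ and $J(2,-2m)$ is the two-bridge knot $b(4m+1,2m+1)$. These are hyperbolic except for the trefoil $J(2,2)$. For $m\ne0$ the group of $J(2,2m)$ has the Wirtinger presentation $\langle x,y\mid w^mx=yw^m\rangle$ with $w=yx^{-1}y^{-1}x$, and a meridian-longitude pair is $\mu=x$, $\lambda=(\overleftarrow{w})^mw^m$, where $\overleftarrow{w}$ is the word $w$ with the order of its letters reversed. **Riley's equation at $s=1$.** For $u\in\mathbb C$ let $X=\begin{pmatrix}1&1\\0&1\end{pmatrix}$, $Y=\begin{pmatrix}1&0\\-u&1\end{pmatrix}$ and $W=YX^{-1}Y^{-1}X$. Then $\phi_{J(2,2m)}(1,u)$ is the $(1,1)$ entry of $W^m$, and $x\mapsto X,\ y\mapsto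 Y$ is a representation of $\Pi(J(2,2m))$ if and only if $\phi_{J(2,2m)}(1,u)=0$. **Holonomy and cusp shape.** For a hyperbolic knot $K$ the complete hyperbolic structure determines the discrete faithful holonomy representation $\Pi(K)\to\mathrm{PSL}_2(\mathbb C)$, which lifts to $\mathrm{SL}_2(\mathbb C)$ (and is considered here up to complex conjugation). The restriction of a lift $\rho_0$ to the peripheral subgroup is, up to conjugation, $\mu\mapsto\pm\begin{pmatrix}1&1\\0&1\end{pmatrix}$, $\lambda\mapsto-\begin{pmatrix}1&\mathfrak c\\0&1\end{pmatrix}$ for a complex number $\mathfrak c=\mathfrak c(\lambda,\mu)$, called the cusp shape of $K$: it is the ratio of the translations of the parabolic isometries given by $\lambda$ and $\mu$. *)

theory Defs
  imports "HOL-Analysis.Analysis" "HOL-Algebra.Coset"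
begin

section \<open>Groups given by generators and relations\<close>

text \<open>Words in the generators and their inverses: \<open>(g, True)\<close> stands for \<open>g\<close> and
  \<open>(g, False)\<close> for its inverse.\<close>

type_synonym 'g word = "('g \<times> bool) list"

definition word_inv :: "'g word \<Rightarrow> 'g word" where
  "word_inv w = rev (map (\<lambda>(g, e). (g, \<not> e)) w)"

definition word_pow :: "'g word \<Rightarrow> int \<Rightarrow> 'g word" where
  "word_pow w k = (if 0 \<le> k then concat (replicate (nat k) w)
                   else concat (replicate (nat (- k)) (word_inv w)))"

text \<open>The congruence on words generated by free cancellation and by the relations
  \<open>l = r\<close> for \<open>(l, r) \<in> R\<close>.\<close>

inductive word_eq :: "('g word \<times> 'g word) set \<Rightarrow> 'g word \<Rightarrow> 'g word \<Rightarrow> bool"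
  for R where
  refl: "word_eq R v v"
| sym: "word_eq R u v \<Longrightarrow> word_eq R v u"
| trans: "word_eq R u v \<Longrightarrow> word_eq R v w \<Longrightarrow> word_eq R u w"
| cancel: "word_eq R (u @ [(g, e), (g, \<not> e)] @ v) (u @ v)"
| relation: "(l, r) \<in> R \<Longrightarrow> word_eq R (u @ l @ v) (u @ r @ v)"

definition word_class :: "('g word \<times> 'g word) set \<Rightarrow> 'g word \<Rightarrow> 'g word set" where
  "word_class R w = {v. word_eq R w v}"

definition presented_group :: "('g word \<times> 'g word) set \<Rightarrow> 'g word set monoid" where
  "presented_group R = \<lparr>carrier = range (word_class R),
     mult = (\<lambda>A B. \<Union>u\<in>A. \<Union>v\<in>B. word_class R (u @ v)),
     one = word_class R []\<rparr>"

lemma word_eq_append_right: "word_eq R u v \<Longrightarrow> word_eq R (a @ u) (a @ v)"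
proof (induction rule: word_eq.induct)
  case (cancel u g e v)
  show ?case using word_eq.cancel[of R "a @ u" g e v] by simp
next
  case (relation l r u v)
  show ?case using word_eq.relation[OF relation, of "a @ u" v] by simp
qed (auto intro: word_eq.intros)

lemma word_eq_append_left: "word_eq R u v \<Longrightarrow> word_eq R (u @ a) (v @ a)"
proof (induction rule: word_eq.induct)
  case (cancel u g e v)
  show ?case using word_eq.cancel[of R u g e "v @ a"] by simp
next
  case (relation l r u v)
  show ?case using word_eq.relation[OF relation, of u "v @ a"] by simp
qed (auto intro: word_eq.intros)

lemma word_class_eq_iff: "word_class R u = word_class R v \<longleftrightarrow> word_eq R u v"
  unfolding word_class_def by (blast intro: word_eq.intros)

lemma presented_group_mult:
  "word_class R u \<otimes>\<^bsub>presented_group R\<^esub> word_class R v = word_class R (u @ v)"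
proof -
  have "word_class R (u' @ v') = word_class R (u @ v)"
    if "u' \<in> word_class R u" "v' \<in> word_class R v" for u' v'
    using that unfolding word_class_eq_iff
    by (simp add: word_class_def)
       (metis (no_types) word_eq.sym word_eq.trans word_eq_append_left word_eq_append_right)
  moreover have "u \<in> word_class R u" "v \<in> word_class R v"
    by (auto simp: word_class_def intro: word_eq.refl)
  ultimately have "(\<Union>u'\<in>word_class R u. \<Union>v'\<in>word_class R v. word_class R (u' @ v'))
      = word_class R (u @ v)"
    by blast
  then show ?thesis by (simp add: presented_group_def)
qed

lemma word_eq_inv: "word_eq R (word_inv w @ w) []"
proof (induction w)
  case Nil
  show ?case by (simp add: word_inv_def word_eq.refl)
next
  case (Cons a w)
  obtain g e where a: "a = (g, e)" by (cases a)
  have "word_eq R (word_inv w @ [(g, \<not> e), (g, \<not> \<not> e)] @ w) (word_inv w @ w)"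
    by (rule word_eq.cancel)
  then show ?case using Cons word_eq.trans by (fastforce simp: a word_inv_def)
qed

lemma group_presented_group: "group (presented_group R)"
proof (rule groupI)
  fix A assume "A \<in> carrier (presented_group R)"
  then obtain w where A: "A = word_class R w" by (auto simp: presented_group_def)
  have "word_class R (word_inv w) \<otimes>\<^bsub>presented_group R\<^esub> A = \<one>\<^bsub>presented_group R\<^esub>"
    unfolding A presented_group_mult
    by (simp add: presented_group_def word_class_eq_iff word_eq_inv)
  then show "\<exists>B\<in>carrier (presented_group R). B \<otimes>\<^bsub>presented_group R\<^esub> A = \<one>\<^bsub>presented_group R\<^esub>"
    by (auto simp: presented_group_def)
next
  have [simp]: "carrier (presented_group R) = range (word_class R)"
    "\<one>\<^bsub>presented_group R\<^esub> = word_class R []"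
    by (simp_all add: presented_group_def)
  show "\<one>\<^bsub>presented_group R\<^esub> \<in> carrier (presented_group R)" by simp
  fix A assume A: "A \<in> carrier (presented_group R)"
  then show "\<one>\<^bsub>presented_group R\<^esub> \<otimes>\<^bsub>presented_group R\<^esub> A = A"
    by (auto simp: presented_group_mult)
  fix B assume B: "B \<in> carrier (presented_group R)"
  with A show "A \<otimes>\<^bsub>presented_group R\<^esub> B \<in> carrier (presented_group R)"
    by (auto simp: presented_group_mult)
  fix C assume "C \<in> carrier (presented_group R)"
  with A B show "A \<otimes>\<^bsub>presented_group R\<^esub> B \<otimes>\<^bsub>presented_group R\<^esub> C
      = A \<otimes>\<^bsub>presented_group R\<^esub> (B \<otimes>\<^bsub>presented_group R\<^esub> C)"
    by (auto simp: presented_group_mult)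
qed

section \<open>The group of the twist knot J(2,2m)\<close>

datatype gen = GenX | GenY

definition w_word :: "gen word" where
  "w_word = [(GenY, True), (GenX, False), (GenY, False), (GenX, True)]"

definition twist_knot_relation :: "int \<Rightarrow> gen word \<times> gen word" where
  "twist_knot_relation m =
     (word_pow w_word m @ [(GenX, True)], [(GenY, True)] @ word_pow w_word m)"

definition twist_knot_group :: "int \<Rightarrow> gen word set monoid" where
  "twist_knot_group m = presented_group {twist_knot_relation m}"

definition knot_elt :: "int \<Rightarrow> gen word \<Rightarrow> gen word set" where
  "knot_elt m v = word_class {twist_knot_relation m} v"

definition gen_x :: "int \<Rightarrow> gen word set" where
  "gen_x m = knot_elt m [(GenX, True)]"

definition gen_y :: "int \<Rightarrow> gen word set" where
  "gen_y m = knot_elt m [(GenY, True)]"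

definition meridian :: "int \<Rightarrow> gen word set" where
  "meridian m = gen_x m"

text \<open>\<open>rev w_word\<close> reverses the order of the letters without inverting them.\<close>

definition longitude :: "int \<Rightarrow> gen word set" where
  "longitude m = knot_elt m (word_pow (rev w_word) m @ word_pow w_word m)"

section \<open>\<open>SL\<^sub>2(\<complex>)\<close> and \<open>PSL\<^sub>2(\<complex>)\<close>\<close>

definition mat22 :: "complex \<Rightarrow> complex \<Rightarrow> complex \<Rightarrow> complex \<Rightarrow> complex^2^2" where
  "mat22 a b c d = vector [vector [a, b], vector [c, d]]"

definition SL2C :: "(complex^2^2) monoid" where
  "SL2C = \<lparr>carrier = {A. det A = 1}, mult = (**), one = mat 1\<rparr>"

definition SL2C_centre :: "(complex^2^2) set" where
  "SL2C_centre = {mat 1, - mat 1}"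

definition PSL2C :: "(complex^2^2) set monoid" where
  "PSL2C = SL2C Mod SL2C_centre"

definition PSL2C_proj :: "complex^2^2 \<Rightarrow> (complex^2^2) set" where
  "PSL2C_proj A = SL2C_centre #>\<^bsub>SL2C\<^esub> A"

lemma det_mat22 [simp]: "det (mat22 a b c d) = a * d - b * c"
  by (simp add: mat22_def det_2)

lemma group_SL2C: "group SL2C"
proof (rule groupI)
  fix A assume "A \<in> carrier SL2C"
  then have A: "det A = 1" by (simp add: SL2C_def)
  then obtain B where B: "B ** A = mat 1"
    using invertible_det_nz[of A] by (auto simp: invertible_def)
  then have "det B = 1"
    using A det_mul[of B A] by simp
  then show "\<exists>B\<in>carrier SL2C. B \<otimes>\<^bsub>SL2C\<^esub> A = \<one>\<^bsub>SL2C\<^esub>"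
    using B by (auto simp: SL2C_def)
qed (auto simp: SL2C_def det_mul matrix_mul_assoc)

lemma SL2C_centre_normal: "SL2C_centre \<lhd> SL2C"
proof -
  interpret group SL2C by (rule group_SL2C)
  have neg: "- mat 1 ** A = - (A :: complex^2^2)" "A ** - mat 1 = - A" for A
    by (vector matrix_matrix_mult_def mat_def sum_2 forall_2; fail)+
  have one: "\<one>\<^bsub>SL2C\<^esub> = mat 1" "(\<otimes>\<^bsub>SL2C\<^esub>) = (**)" by (simp_all add: SL2C_def)
  have sub: "SL2C_centre \<subseteq> carrier SL2C"
    by (auto simp: SL2C_centre_def SL2C_def det_2 mat_def)
  have m1: "- mat 1 \<in> carrier SL2C" "mat 1 \<in> carrier SL2C"
    using sub by (auto simp: SL2C_centre_def)
  have inv1: "inv\<^bsub>SL2C\<^esub> (- mat 1) = - mat 1"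
    by (rule inv_equality) (use m1 in \<open>simp_all add: one neg\<close>)
  have "subgroup SL2C_centre SL2C"
    by (rule subgroupI)
       (use sub inv1 inv_one in \<open>auto simp: SL2C_centre_def one neg\<close>)
  moreover have "A \<otimes>\<^bsub>SL2C\<^esub> h \<otimes>\<^bsub>SL2C\<^esub> inv\<^bsub>SL2C\<^esub> A \<in> SL2C_centre"
    if A: "A \<in> carrier SL2C" and h: "h \<in> SL2C_centre" for A h
  proof -
    have "A \<otimes>\<^bsub>SL2C\<^esub> h = h \<otimes>\<^bsub>SL2C\<^esub> A"
      using h by (auto simp: SL2C_centre_def one neg)
    moreover have "h \<in> carrier SL2C" using h sub by blast
    ultimately show ?thesis using A h by (simp add: m_assoc)
  qed
  ultimately show ?thesis by (simp add: normal_inv_iff)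
qed

lemma group_PSL2C: "group PSL2C"
  unfolding PSL2C_def by (rule normal.factorgroup_is_group[OF SL2C_centre_normal])

section \<open>Holonomy, cusp shape and Riley's equation\<close>

text \<open>The elements of \<open>PSL2C\<close> are the sets \<open>{A, - A}\<close>, so the union of a subset \<open>\<Gamma>\<close>
  of \<open>PSL2C\<close> is its preimage in \<open>SL2C\<close>.  Since the projection is a covering map, \<open>\<Gamma>\<close> is
  discrete in the quotient topology iff this preimage is a discrete set of matrices.\<close>

definition discrete_in_PSL2C :: "(complex^2^2) set set \<Rightarrow> bool" where
  "discrete_in_PSL2C \<Gamma> \<longleftrightarrow> discrete (\<Union>\<Gamma>)"

text \<open>The holonomy representation of the complete hyperbolic structure on the knot
  complement is the discrete faithful representation into \<open>PSL\<^sub>2(\<complex>)\<close>; by Mostow--Prasad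
  rigidity it is unique up to conjugation and complex conjugation.\<close>

definition is_holonomy :: "int \<Rightarrow> (gen word set \<Rightarrow> (complex^2^2) set) \<Rightarrow> bool" where
  "is_holonomy m h \<longleftrightarrow>
     h \<in> hom (twist_knot_group m) PSL2C \<and>
     inj_on h (carrier (twist_knot_group m)) \<and>
     discrete_in_PSL2C (h ` carrier (twist_knot_group m))"

definition is_holonomy_lift :: "int \<Rightarrow> (gen word set \<Rightarrow> complex^2^2) \<Rightarrow> bool" where
  "is_holonomy_lift m \<rho> \<longleftrightarrow>
     \<rho> \<in> hom (twist_knot_group m) SL2C \<and> is_holonomy m (PSL2C_proj \<circ> \<rho>)"

definition is_cusp_shape :: "int \<Rightarrow> (gen word set \<Rightarrow> complex^2^2) \<Rightarrow> complex \<Rightarrow> bool" where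
  "is_cusp_shape m \<rho> c \<longleftrightarrow>
     (\<exists>P\<in>carrier SL2C.
        P ** \<rho> (meridian m) ** (inv\<^bsub>SL2C\<^esub> P) \<in> {mat22 1 1 0 1, - mat22 1 1 0 1} \<and>
        P ** \<rho> (longitude m) ** (inv\<^bsub>SL2C\<^esub> P) = - mat22 1 c 0 1)"

definition X_mat :: "complex^2^2" where
  "X_mat = mat22 1 1 0 1"

definition Y_mat :: "complex \<Rightarrow> complex^2^2" where
  "Y_mat u = mat22 1 0 (- u) 1"

definition W_mat :: "complex \<Rightarrow> complex^2^2" where
  "W_mat u = Y_mat u ** (inv\<^bsub>SL2C\<^esub> X_mat) ** (inv\<^bsub>SL2C\<^esub> (Y_mat u)) ** X_mat"

text \<open>\<open>riley m u\<close> is \<open>\<phi>(1,u)\<close> for the knot \<open>J(2,2m)\<close>.\<close>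

definition riley :: "int \<Rightarrow> complex \<Rightarrow> complex" where
  "riley m u = (W_mat u [^]\<^bsub>SL2C\<^esub> m) $ 1 $ 1"

end

theory Submission
  imports Defs
begin

text \<open>Every power of \<open>W\<close> lies in the commutative algebra spanned by the identity and
  the matrix with rows \<open>(0, 1)\<close> and \<open>(- u, - (u + 2))\<close>, because \<open>W\<close> does.  The
  reversed word evaluates to the reflection of \<open>W\<close> in the antidiagonal, and this reflection
  is an anti-automorphism, so the longitude goes to the reflection of \<open>W\<^sup>m\<close> times
  \<open>W\<^sup>m\<close>.  If \<open>W\<^sup>m\<close> has first row \<open>(0, b)\<close>, its second row is
  \<open>(- u b, - (u + 2) b)\<close>, the determinant gives \<open>u b\<^sup>2 = 1\<close>, and the product is minus
  the unipotent matrix with translation \<open>2 (u + 2) b\<^sup>2 = (2 u + 4) / u\<close>.  A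
  conjugation fixing \<open>X\<close> up to sign is by plus or minus an upper unipotent matrix, so it
  does not change this translation.\<close>

section \<open>Two by two matrices\<close>

lemma mat22_nth [simp]:
  "mat22 a b c d $ 1 $ 1 = a" "mat22 a b c d $ 1 $ 2 = b"
  "mat22 a b c d $ 2 $ 1 = c" "mat22 a b c d $ 2 $ 2 = d"
  by (simp_all add: mat22_def)

lemma mat22_eq_iff [simp]:
  "mat22 a b c d = mat22 a' b' c' d' \<longleftrightarrow> a = a' \<and> b = b' \<and> c = c' \<and> d = d'"
  by (metis mat22_nth)

lemma mat22_cases: obtains a b c d where "A = mat22 a b c d"
proof
  show "A = mat22 (A $ 1 $ 1) (A $ 1 $ 2) (A $ 2 $ 1) (A $ 2 $ 2)"
    by (simp add: vec_eq_iff forall_2)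
qed

lemma mat22_mult [simp]:
  "mat22 a b c d ** mat22 a' b' c' d' =
     mat22 (a * a' + b * c') (a * b' + b * d') (c * a' + d * c') (c * b' + d * d')"
  by (simp add: vec_eq_iff forall_2 matrix_matrix_mult_def sum_2)

lemma uminus_mat22 [simp]: "- mat22 a b c d = mat22 (- a) (- b) (- c) (- d)"
  by (simp add: vec_eq_iff forall_2)

lemma mat_1_eq_mat22: "mat 1 = mat22 1 0 0 1"
  by (simp add: vec_eq_iff forall_2 mat_def)

lemma SL2C_simps:
  "A \<in> carrier SL2C \<longleftrightarrow> det A = 1" "A \<otimes>\<^bsub>SL2C\<^esub> B = A ** B" "\<one>\<^bsub>SL2C\<^esub> = mat22 1 0 0 1"
  by (simp_all add: SL2C_def mat_1_eq_mat22)

interpretation SL2C: group SL2C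
  by (rule group_SL2C)

lemma inv_SL2C_mat22:
  assumes "a * d - b * c = 1"
  shows "inv\<^bsub>SL2C\<^esub> (mat22 a b c d) = mat22 d (- b) (- c) a"
  by (rule SL2C.inv_equality) (use assms in \<open>auto simp: SL2C_simps algebra_simps\<close>)

text \<open>This is the transpose conjugated by the permutation matrix that swaps the coordinates,
  hence it reverses products. It fixes \<open>X_mat\<close> and \<open>Y_mat u\<close>, whose
  diagonal entries are equal.\<close>

definition antitranspose :: "complex^2^2 \<Rightarrow> complex^2^2" where
  "antitranspose A = mat22 (A $ 2 $ 2) (A $ 1 $ 2) (A $ 2 $ 1) (A $ 1 $ 1)"

lemma antitranspose_mat22 [simp]: "antitranspose (mat22 a b c d) = mat22 d b c a"
  by (simp add: antitranspose_def)

lemma det_antitranspose [simp]: "det (antitranspose A) = det A"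
  by (cases A rule: mat22_cases) simp

lemma antitranspose_mult: "antitranspose (A ** B) = antitranspose B ** antitranspose A"
  by (cases A rule: mat22_cases; cases B rule: mat22_cases) (simp add: algebra_simps)

lemma antitranspose_inv:
  "det A = 1 \<Longrightarrow> inv\<^bsub>SL2C\<^esub> (antitranspose A) = antitranspose (inv\<^bsub>SL2C\<^esub> A)"
  by (cases A rule: mat22_cases) (simp add: inv_SL2C_mat22 mult.commute)

lemma antitranspose_nat_pow:
  assumes "det A = 1"
  shows "antitranspose A [^]\<^bsub>SL2C\<^esub> (n :: nat) = antitranspose (A [^]\<^bsub>SL2C\<^esub> n)"
proof (induction n)
  case 0
  show ?case by (simp add: SL2C_simps)
next
  case (Suc n)
  have "A \<in> carrier SL2C" "antitranspose A \<in> carrier SL2C"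
    using assms by (simp_all add: SL2C_simps)
  \<comment> \<open>Reversing the product moves the last factor to the front, so the power has to be
    unfolded on the left.\<close>
  then show ?case
    using Suc SL2C.nat_pow_Suc2[of "antitranspose A" n]
    by (simp add: SL2C_simps antitranspose_mult)
qed

lemma antitranspose_int_pow:
  assumes "det A = 1"
  shows "antitranspose A [^]\<^bsub>SL2C\<^esub> (k :: int) = antitranspose (A [^]\<^bsub>SL2C\<^esub> k)"
proof -
  have det: "det (A [^]\<^bsub>SL2C\<^esub> n) = 1" for n :: nat
    using SL2C.nat_pow_closed[of A n] assms unfolding SL2C_simps by blast
  show ?thesis
    unfolding int_pow_def2 antitranspose_nat_pow[OF assms] antitranspose_inv[OF det] by simp
qed

section \<open>Powers of Riley's matrix\<close>

text \<open>With \<open>N\<close> the matrix with rows \<open>(0, 1)\<close> and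
  \<open>(- u, - (u + 2))\<close>, these are the combinations a I + b N. The relation N^2 = - (u +
  2) N - u I closes them under products.\<close>

definition riley_algebra :: "complex \<Rightarrow> (complex^2^2) set" where
  "riley_algebra u = {mat22 a b (- (u * b)) (a - (u + 2) * b) | a b. True}"

lemma mat22_in_riley_algebra:
  "mat22 a b c d \<in> riley_algebra u \<longleftrightarrow> c = - (u * b) \<and> d = a - (u + 2) * b"
  by (auto simp: riley_algebra_def)

lemma riley_algebra_mult:
  "A \<in> riley_algebra u \<Longrightarrow> B \<in> riley_algebra u \<Longrightarrow> A ** B \<in> riley_algebra u"
  by (cases A rule: mat22_cases; cases B rule: mat22_cases)
     (clarsimp simp: mat22_in_riley_algebra; simp add: algebra_simps)

text \<open>For determinant 1 the inverse is the adjugate, which is the trace times the identity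
  minus \<open>A\<close>.\<close>

lemma riley_algebra_inv:
  "A \<in> riley_algebra u \<Longrightarrow> det A = 1 \<Longrightarrow> inv\<^bsub>SL2C\<^esub> A \<in> riley_algebra u"
  by (cases A rule: mat22_cases)
     (clarsimp simp: mat22_in_riley_algebra inv_SL2C_mat22; simp (no_asm) add: algebra_simps)

lemma riley_algebra_nat_pow:
  "A \<in> riley_algebra u \<Longrightarrow> A [^]\<^bsub>SL2C\<^esub> (n :: nat) \<in> riley_algebra u"
proof (induction n)
  case 0
  show ?case by (simp add: SL2C_simps mat22_in_riley_algebra)
next
  case (Suc n)
  then show ?case by (simp add: SL2C_simps riley_algebra_mult)
qed

lemma riley_algebra_int_pow:
  assumes "A \<in> riley_algebra u" "det A = 1"
  shows "A [^]\<^bsub>SL2C\<^esub> (k :: int) \<in> riley_algebra u"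
proof -
  have det: "det (A [^]\<^bsub>SL2C\<^esub> n) = 1" for n :: nat
    using SL2C.nat_pow_closed[of A n] assms unfolding SL2C_simps by blast
  show ?thesis
    unfolding int_pow_def2
    using riley_algebra_nat_pow[OF assms(1)] riley_algebra_inv[OF _ det] by (simp del: pow_nat)
qed

lemma W_mat_eq: "W_mat u = mat22 (1 - u) (- u) (u * u) (u * u + u + 1)"
  by (simp add: W_mat_def X_mat_def Y_mat_def inv_SL2C_mat22 algebra_simps)

lemma det_W_mat: "det (W_mat u) = 1"
  by (simp add: W_mat_eq algebra_simps)

lemma riley_root_longitude:
  assumes "riley m u = 0"
  shows "u \<noteq> 0"
    and "antitranspose (W_mat u) [^]\<^bsub>SL2C\<^esub> m ** W_mat u [^]\<^bsub>SL2C\<^esub> m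
           = - mat22 1 ((2 * u + 4) / u) 0 1"
proof -
  \<comment> \<open>In the basis I, N the coordinates of \<open>W_mat u\<close> are
    \<open>1 - u\<close> and \<open>- u\<close>.\<close>
  have "W_mat u \<in> riley_algebra u"
    by (simp add: W_mat_eq mat22_in_riley_algebra algebra_simps)
  then have mem: "W_mat u [^]\<^bsub>SL2C\<^esub> m \<in> riley_algebra u"
    using det_W_mat by (rule riley_algebra_int_pow)
  obtain a b c d where pow: "W_mat u [^]\<^bsub>SL2C\<^esub> m = mat22 a b c d"
    by (rule mat22_cases)
  \<comment> \<open>Riley's equation kills the coefficient of the identity, so the power is
    \<open>b\<close> times N.\<close>
  have entries: "a = 0" "c = - (u * b)" "d = - ((u + 2) * b)"
    using assms mem by (auto simp: riley_def pow mat22_in_riley_algebra)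
  have "det (W_mat u [^]\<^bsub>SL2C\<^esub> m) = 1"
    using SL2C.int_pow_closed[of "W_mat u" m] by (simp add: SL2C_simps det_W_mat)
  then have ub: "u * (b * b) = 1"
    by (simp add: pow entries algebra_simps)
  then show u: "u \<noteq> 0" by auto
  \<comment> \<open>As \<open>a = 0\<close>, the product of the reflected power with the power has
    both diagonal entries \<open>b * c\<close>, lower left entry 0 and this upper right
    entry.\<close>
  have "d * b + b * d = - 2 * (u + 2) * (b * b)"
    by (simp add: entries algebra_simps)
  also have "b * b = 1 / u" using ub u by (metis nonzero_mult_div_cancel_left)
  also have "- 2 * (u + 2) * (1 / u) = - ((2 * u + 4) / u)" using u by (simp add: field_simps)
  finally have db: "d * b + b * d = - ((2 * u + 4) / u)" .
  have bc: "b * c = - 1" using ub by (simp add: entries(2) mult.left_commute)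
  show "antitranspose (W_mat u) [^]\<^bsub>SL2C\<^esub> m ** W_mat u [^]\<^bsub>SL2C\<^esub> m
      = - mat22 1 ((2 * u + 4) / u) 0 1"
    using db bc by (simp add: antitranspose_int_pow det_W_mat pow entries(1) mult.commute)
qed

section \<open>Evaluating words\<close>

interpretation knot_group: group "twist_knot_group m" for m
  unfolding twist_knot_group_def by (rule group_presented_group)

lemma knot_elt_closed [simp]: "knot_elt m v \<in> carrier (twist_knot_group m)"
  by (simp add: knot_elt_def twist_knot_group_def presented_group_def)

lemma knot_elt_Nil: "knot_elt m [] = \<one>\<^bsub>twist_knot_group m\<^esub>"
  by (simp add: knot_elt_def twist_knot_group_def presented_group_def)

lemma knot_elt_append:
  "knot_elt m (u @ v) = knot_elt m u \<otimes>\<^bsub>twist_knot_group m\<^esub> knot_elt m v"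
  by (simp add: knot_elt_def twist_knot_group_def presented_group_mult)

lemma knot_elt_word_inv: "knot_elt m (word_inv v) = inv\<^bsub>twist_knot_group m\<^esub> knot_elt m v"
proof (rule knot_group.inv_equality [symmetric])
  show "knot_elt m (word_inv v) \<otimes>\<^bsub>twist_knot_group m\<^esub> knot_elt m v = \<one>\<^bsub>twist_knot_group m\<^esub>"
    unfolding knot_elt_append [symmetric] knot_elt_Nil [symmetric]
    by (simp add: knot_elt_def word_class_eq_iff word_eq_inv)
qed simp_all

lemma knot_elt_replicate:
  "knot_elt m (concat (replicate n v)) = knot_elt m v [^]\<^bsub>twist_knot_group m\<^esub> n"
proof (induction n)
  case 0
  show ?case by (simp add: knot_elt_Nil)
next
  case (Suc n)
  then show ?case
    \<comment> \<open>\<open>replicate\<close> adds the new copy of \<open>v\<close> in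
      front.\<close>
    using knot_group.nat_pow_Suc2[of "knot_elt m v" m n] by (simp add: knot_elt_append)
qed

lemma knot_elt_word_pow:
  "knot_elt m (word_pow v k) = knot_elt m v [^]\<^bsub>twist_knot_group m\<^esub> k"
  by (simp add: word_pow_def int_pow_def2 knot_elt_replicate knot_elt_word_inv
      knot_group.nat_pow_inv del: pow_nat)

lemma knot_elt_letters:
  "knot_elt m [(GenX, True)] = gen_x m"
  "knot_elt m [(GenY, True)] = gen_y m"
  "knot_elt m [(GenX, False)] = inv\<^bsub>twist_knot_group m\<^esub> gen_x m"
  "knot_elt m [(GenY, False)] = inv\<^bsub>twist_knot_group m\<^esub> gen_y m"
  using knot_elt_word_inv[of m "[(GenX, True)]"] knot_elt_word_inv[of m "[(GenY, True)]"]
  by (simp_all add: gen_x_def gen_y_def word_inv_def)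

lemma hom_longitude:
  assumes hom: "\<rho> \<in> hom (twist_knot_group m) SL2C"
    and x: "\<rho> (gen_x m) = X_mat" and y: "\<rho> (gen_y m) = Y_mat u"
  shows "\<rho> (longitude m) = antitranspose (W_mat u) [^]\<^bsub>SL2C\<^esub> m ** W_mat u [^]\<^bsub>SL2C\<^esub> m"
proof -
  interpret \<rho>: group_hom "twist_knot_group m" SL2C \<rho>
    by unfold_locales (rule hom)
  have app: "\<rho> (knot_elt m (v @ v')) = \<rho> (knot_elt m v) ** \<rho> (knot_elt m v')" for v v'
    by (simp add: knot_elt_append SL2C_simps)
  have closed: "gen_x m \<in> carrier (twist_knot_group m)" "gen_y m \<in> carrier (twist_knot_group m)"
    by (simp_all add: gen_x_def gen_y_def)
  have letters: "\<rho> (knot_elt m [(GenX, True)]) = mat22 1 1 0 1"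
    "\<rho> (knot_elt m [(GenY, True)]) = mat22 1 0 (- u) 1"
    "\<rho> (knot_elt m [(GenX, False)]) = mat22 1 (- 1) 0 1"
    "\<rho> (knot_elt m [(GenY, False)]) = mat22 1 0 u 1"
    unfolding knot_elt_letters \<rho>.hom_inv[OF closed(1)] \<rho>.hom_inv[OF closed(2)] x y
    by (simp_all add: X_mat_def Y_mat_def inv_SL2C_mat22)
  have four: "\<rho> (knot_elt m [p, q, r, s]) = \<rho> (knot_elt m [p]) ** \<rho> (knot_elt m [q])
      ** \<rho> (knot_elt m [r]) ** \<rho> (knot_elt m [s])" for p q r s
    using app[of "[p, q, r]" "[s]"] app[of "[p, q]" "[r]"] app[of "[p]" "[q]"] by simp
  \<comment> \<open>The reflection fixes the images of both generators and of their inverses, so on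
    products of letters it only reverses the order.\<close>
  have "\<rho> (knot_elt m w_word) = W_mat u"
    "\<rho> (knot_elt m (rev w_word)) = antitranspose (W_mat u)"
    by (simp_all add: w_word_def four letters W_mat_eq algebra_simps)
  then show ?thesis
    by (simp add: longitude_def app knot_elt_word_pow \<rho>.hom_int_pow)
qed

section \<open>The cusp shape\<close>

text \<open>The first condition makes \<open>P\<close> upper triangular with diagonal entries both 1
  or both -1, and such a \<open>P\<close> commutes with every upper unipotent matrix.\<close>

lemma upper_unipotent_conj_unique:
  assumes P: "det P = 1"
    and X: "P ** X_mat ** inv\<^bsub>SL2C\<^esub> P \<in> {mat22 1 1 0 1, - mat22 1 1 0 1}"
    and L: "P ** - mat22 1 c 0 1 ** inv\<^bsub>SL2C\<^esub> P = - mat22 1 c' 0 1"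
  shows "c' = c"
proof -
  obtain p q r s where PM: "P = mat22 p q r s" by (rule mat22_cases)
  have dt: "p * s - q * r = 1" using P by (simp add: PM)
  have inv: "inv\<^bsub>SL2C\<^esub> P = mat22 s (- q) (- r) p"
    unfolding PM using dt by (rule inv_SL2C_mat22)
  have "P ** X_mat ** inv\<^bsub>SL2C\<^esub> P
      = mat22 ((p * s - q * r) - p * r) (p * p) (- (r * r)) ((p * s - q * r) + p * r)"
    unfolding inv by (simp add: PM X_mat_def algebra_simps)
  then have "P ** X_mat ** inv\<^bsub>SL2C\<^esub> P = mat22 (1 - p * r) (p * p) (- (r * r)) (1 + p * r)"
    unfolding dt .
  \<comment> \<open>The lower left entry forces \<open>r = 0\<close>. The diagonal is then 1, which
    rules out the negative sign and leaves \<open>p * p = 1\<close> in the upper right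
    corner.\<close>
  then have r: "r = 0" and "p * p = 1"
    using X by auto
  moreover have "p * q + (- (p * c) - q) * p = - c'"
    using L unfolding inv by (simp add: PM r)
  then have "p * p * c = c'"
    by algebra
  ultimately show ?thesis by simp
qed

theorem mainTheorem3:
  fixes m :: int and u0 :: complex and \<rho>0 :: "gen word set \<Rightarrow> complex^2^2"
  assumes "m \<notin> {0, 1}"
    and "riley m u0 = 0"
    and "is_holonomy_lift m \<rho>0"
    and "\<rho>0 (gen_x m) = X_mat"
    and "\<rho>0 (gen_y m) = Y_mat u0"
  shows "u0 \<noteq> 0 \<and>
    (\<forall>c. is_cusp_shape m \<rho>0 c \<longleftrightarrow> c = (2 * u0 + 4) / u0) \<and>
    (\<forall>c. is_cusp_shape m \<rho>0 c \<longleftrightarrow> c \<noteq> 2 \<and> u0 = 4 / (c - 2))"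
proof -
  let ?c = "(2 * u0 + 4) / u0"
  have u0: "u0 \<noteq> 0" using assms(2) by (rule riley_root_longitude)
  have "\<rho>0 \<in> hom (twist_knot_group m) SL2C"
    using assms(3) by (simp add: is_holonomy_lift_def)
  then have long: "\<rho>0 (longitude m) = - mat22 1 ?c 0 1"
    using hom_longitude assms(4,5) riley_root_longitude(2)[OF assms(2)] by metis
  have mer: "\<rho>0 (meridian m) = X_mat"
    using assms(4) by (simp add: meridian_def)
  have shape: "is_cusp_shape m \<rho>0 c \<longleftrightarrow> c = ?c" for c
  proof
    assume "is_cusp_shape m \<rho>0 c"
    then show "c = ?c"
      unfolding is_cusp_shape_def mer long
      by (metis SL2C_simps(1) upper_unipotent_conj_unique)
  next
    assume "c = ?c"
    then show "is_cusp_shape m \<rho>0 c"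
      unfolding is_cusp_shape_def mer long
      \<comment> \<open>Meridian and longitude are already in normal form, so the identity
        conjugates.\<close>
      by (intro bexI[of _ "mat22 1 0 0 1"])
         (simp_all add: SL2C_simps inv_SL2C_mat22 X_mat_def)
  qed
  \<comment> \<open>Thus \<open>?c - 2\<close> and \<open>u0\<close> have product 4, and each
    determines the other.\<close>
  have c: "?c - 2 = 4 / u0" using u0 by (simp add: field_simps)
  have "c = ?c \<longleftrightarrow> c \<noteq> 2 \<and> u0 = 4 / (c - 2)" for c
  proof
    assume "c = ?c"
    then show "c \<noteq> 2 \<and> u0 = 4 / (c - 2)" using c u0 by auto
  next
    assume "c \<noteq> 2 \<and> u0 = 4 / (c - 2)"
    then have "c - 2 = 4 / u0" by auto
    then show "c = ?c" unfolding c [symmetric] by simp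
  qed
  then show ?thesis using u0 shape by blast
qed

end
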